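(* Let $\Omega$ be the annulus $\{z\in\mathbb{C}:\rho<|z|<1\}$, $0<\rho<1$, bounded by $\Gamma$. For $a\in\Omega$, $z\in\Omega\cup\Gamma$, $t>0$, the weighted Szegő kernel $S_\rho^t(z,a)$ for $\Omega$ can be represented by $$S_\rho^t(z,a)=\frac{1}{2\pi(1+t)}\;{}_1\psi_1(-t;-t\rho^2;\rho^2;\overline{a}z)$$ $$=\frac{1}{2\pi}\prod_{n=0}^{\infty}\frac{(1+t\overline{a}z\rho^{2n})(\overline{a}z+\rho^{2n+2}/t)(1-\rho^{2n+2})^2}{(1-\overline{a}z\rho^{2n})(\overline{a}z-\rho^{2n+2})(1+\rho^{2n+2}/t)(1+t\rho^{2n})}.$$ The kernel $S_\rho^t(z,a)$ has a zero in $\Omega$ only if $t$ takes the form $t=\rho^{\pm(2m+1)}$, $m=0,1,2,\dots$. In both cases, the zero is $z=-\rho/\overline{a}$.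
   Context: The boundary $\Gamma$ of $\Omega$ consists of the circles $|z|=1$ and $|z|=\rho$. For $t>0$ the weighted Szegő kernel for $\Omega$ is defined by $$S_\rho^t(z,a)=\frac{1}{2\pi}\sum_{n=-\infty}^{\infty}\frac{(\overline{a}z)^n}{1+t\rho^{2n}},$$ and the same series is used for $z\in\Gamma$; it converges for $a\in\Omega$, $z\in\Omega\cup\Gamma$ since then $\rho^2<|\overline{a}z|<1$. For $0<q<1$ and $\alpha\in\mathbb{C}$ the $q$-shifted factorial is $(\alpha;q)_0=1$, $(\alpha;q)_n=\prod_{k=0}^{n-1}(1-\alpha q^k)$ for $n\ge1$, and $(\alpha;q)_n=\prod_{k=1}^{|n|}(1-\alpha q^{-k})^{-1}$ for $n\le-1$. The bilateral basic hypergeometric series with one numerator and one denominator parameter is $${}_1\psi_1(\alpha;\beta;q;z)=\sum_{n=-\infty}^{\infty}\frac{(\alpha;q)_n}{(\beta;q)_n}z^n,\qquad |\beta/\alpha|<|z|<1.$$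
   Formalization: The "only if" sentence is proved assuming the kernel has a zero in Ω for every a in Ω; for a single fixed a it is false, e.g. |a|=ρ^(1/3), t=ρ^(-5/6) gives the zero z=-1/(t·conj(a)) with |z|=ρ^(1/2). *)

theory Defs
  imports "HOL-Analysis.Analysis"
begin

definition annulus :: "real \<Rightarrow> complex set" where
  "annulus \<rho> = {z. \<rho> < norm z \<and> norm z < 1}"

definition annulus_boundary :: "real \<Rightarrow> complex set" where
  "annulus_boundary \<rho> = sphere 0 1 \<union> sphere 0 \<rho>"

definition szego_term :: "real \<Rightarrow> real \<Rightarrow> complex \<Rightarrow> complex \<Rightarrow> int \<Rightarrow> complex" where
  "szego_term \<rho> t z a n = (cnj a * z) powi n / of_real (1 + t * \<rho> powi (2 * n))"

text \<open>
  Bilateral series are unordered sums over all integers, so convergence means absolute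
  convergence; \<open>infsum\<close> is 0 when the family is not summable.
\<close>

definition szego :: "real \<Rightarrow> real \<Rightarrow> complex \<Rightarrow> complex \<Rightarrow> complex" where
  "szego \<rho> t z a = 1 / (2 * of_real pi) * (\<Sum>\<^sub>\<infinity>n\<in>UNIV. szego_term \<rho> t z a n)"

definition qpoch :: "complex \<Rightarrow> real \<Rightarrow> int \<Rightarrow> complex" where
  "qpoch \<alpha> q n =
     (if n \<ge> 0 then (\<Prod>k<nat n. 1 - \<alpha> * of_real q ^ k)
      else (\<Prod>k=1..nat \<bar>n\<bar>. inverse (1 - \<alpha> * of_real q powi (- int k))))"

definition psi11_term :: "complex \<Rightarrow> complex \<Rightarrow> real \<Rightarrow> complex \<Rightarrow> int \<Rightarrow> complex" where
  "psi11_term \<alpha> \<beta> q z n = qpoch \<alpha> q n / qpoch \<beta> q n * z powi n"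

text \<open>Meaningful for \<open>0 < q < 1\<close> and \<open>norm (\<beta> / \<alpha>) < norm z < 1\<close>.\<close>

definition psi11 :: "complex \<Rightarrow> complex \<Rightarrow> real \<Rightarrow> complex \<Rightarrow> complex" where
  "psi11 \<alpha> \<beta> q z = (\<Sum>\<^sub>\<infinity>n\<in>UNIV. psi11_term \<alpha> \<beta> q z n)"

definition szego_factor :: "real \<Rightarrow> real \<Rightarrow> complex \<Rightarrow> complex \<Rightarrow> nat \<Rightarrow> complex" where
  "szego_factor \<rho> t z a n =
     ((1 + of_real t * cnj a * z * of_real \<rho> ^ (2 * n))
        * (cnj a * z + of_real \<rho> ^ (2 * n + 2) / of_real t)
        * (1 - of_real \<rho> ^ (2 * n + 2)) ^ 2)
     / ((1 - cnj a * z * of_real \<rho> ^ (2 * n))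
        * (cnj a * z - of_real \<rho> ^ (2 * n + 2))
        * (1 + of_real \<rho> ^ (2 * n + 2) / of_real t)
        * (1 + of_real t * of_real \<rho> ^ (2 * n)))"

end

theory Submission imports Defs begin

text \<open>
  Put \<open>q = \<rho>\<^sup>2\<close> and \<open>x = cnj a * z\<close>, so that \<open>q < norm x < 1\<close>. Up to the factor
  \<open>1 / (2 * pi)\<close> the kernel is the bilateral series \<open>\<Sum>k. x\<^sup>k / (1 + t * q\<^sup>k)\<close>. The quotient of the
  two shifted factorials with parameters \<open>- t\<close> and \<open>- t * q\<close> telescopes to
  \<open>(1 + t) / (1 + t * q\<^sup>k)\<close>, which makes the hypergeometric representation a rewriting of each term
  (\<open>qpoch_ratio_shift\<close>).

  The product formula is a special case of Ramanujan's summation of the bilateral series. It is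
  obtained here by reading the series as a partial fraction expansion in the weight \<open>t\<close>. The finite
  product of \<open>(1 + t * x * q\<^sup>n) / (1 + t * q\<^sup>n)\<close> over \<open>- N \<le> n < N\<close> is a rational function of \<open>t\<close>
  with simple poles, hence equal to \<open>x\<close> to the power \<open>2 * N\<close> plus a sum of terms
  \<open>r\<^sub>k / (1 + t * q\<^sup>k)\<close> (\<open>prod_linear_fractions_expand\<close>). Here \<open>r\<^sub>k\<close> is \<open>x\<^sup>N * x\<^sup>k\<close> times two finite
  q-products of lengths about \<open>N - k\<close> and \<open>N + k\<close> (\<open>residue_eq_qpoch\<close>). As the lengths grow these converge, so they
  are bounded independently of \<open>k\<close> and \<open>N\<close>, and after division by \<open>x\<^sup>N\<close> dominated convergence gives
  the series on one side and the infinite product on the other (\<open>kronecker_series_eq_product\<close>).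

  The zeros are then those of the factors in the numerator: \<open>x\<close> is one of the points
  \<open>- \<rho>\<^sup>2\<^sup>k / t\<close> with \<open>k\<close> an integer (\<open>szego_eq_0_iff\<close>). Their moduli form a geometric sequence of ratio \<open>\<rho>\<^sup>2\<close>,
  whereas \<open>norm x\<close> runs through an interval from \<open>\<rho> * norm a\<close> to \<open>norm a\<close>, of ratio only \<open>\<rho>\<close>. Such an
  interval can miss the sequence, and the only way for it to meet the sequence for every \<open>a\<close> in the
  annulus is that \<open>\<rho>\<close> itself belongs to the sequence. This says that \<open>t\<close> is an odd power of \<open>\<rho>\<close>,
  and then the zero is at \<open>x = - \<rho>\<close>.
\<close>

section \<open>Infinite q-products\<close>

definition qpoch_inf :: "complex \<Rightarrow> real \<Rightarrow> complex" where
  "qpoch_inf y q = (\<Prod>n. 1 - y * of_real q ^ n)"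

lemma qpoch_of_nat: "qpoch y q (int n) = (\<Prod>k<n. 1 - y * of_real q ^ k)"
  by (simp add: qpoch_def)

lemma convergent_prod_qpoch_factors:
  assumes "\<bar>q\<bar> < 1"
  shows "convergent_prod (\<lambda>n. 1 - y * of_real q ^ n :: complex)"
proof -
  have "summable (\<lambda>n. norm y * \<bar>q\<bar> ^ n)"
    using assms by (intro summable_mult summable_geometric) auto
  then show ?thesis
    by (intro abs_convergent_prod_imp_convergent_prod summable_imp_abs_convergent_prod)
       (simp add: norm_mult norm_power)
qed

lemma qpoch_tendsto_qpoch_inf:
  assumes "\<bar>q\<bar> < 1"
  shows "(\<lambda>n. qpoch y q (int n)) \<longlonglongrightarrow> qpoch_inf y q"
  unfolding qpoch_inf_def qpoch_of_nat
  using convergent_prod_LIMSEQ[OF convergent_prod_qpoch_factors[OF assms, of y]]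
  by (subst (asm) lessThan_Suc_atMost[symmetric], subst (asm) filterlim_sequentially_Suc)

lemma qpoch_inf_eq_0_iff:
  assumes "\<bar>q\<bar> < 1"
  shows "qpoch_inf y q = 0 \<longleftrightarrow> (\<exists>n. y * of_real q ^ n = 1)"
proof
  assume "qpoch_inf y q = 0"
  then show "\<exists>n. y * of_real q ^ n = 1"
    using prodinf_nonzero[OF convergent_prod_qpoch_factors[OF assms, of y]]
    unfolding qpoch_inf_def by auto
next
  assume "\<exists>n. y * of_real q ^ n = 1"
  then obtain n where n: "y * of_real q ^ n = 1" by blast
  have "\<forall>\<^sub>F N in sequentially. qpoch y q (int N) = 0"
    using eventually_gt_at_top[of n]
    by eventually_elim (auto simp: qpoch_of_nat n intro!: prod_zero bexI[of _ n])
  then have "(\<lambda>N. qpoch y q (int N)) \<longlonglongrightarrow> 0"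
    by (rule tendsto_eventually)
  with qpoch_tendsto_qpoch_inf[OF assms] show "qpoch_inf y q = 0"
    by (rule LIMSEQ_unique)
qed

lemma qpoch_nonzero:
  assumes "0 < q" "q < 1" "norm y < 1"
  shows "1 - y * of_real q ^ n \<noteq> 0" "qpoch y q (int n) \<noteq> 0" "qpoch_inf y q \<noteq> 0"
proof -
  have *: "y * of_real q ^ m \<noteq> 1" for m :: nat
  proof
    assume "y * of_real q ^ m = 1"
    then have "norm y * q ^ m = 1"
      using assms by (metis abs_of_pos norm_mult norm_of_real norm_one norm_power)
    moreover have "norm y * q ^ m \<le> norm y * 1"
      using assms by (intro mult_left_mono power_le_one) auto
    ultimately show False using assms by simp
  qed
  show "1 - y * of_real q ^ n \<noteq> 0" using *[of n] by auto
  show "qpoch y q (int n) \<noteq> 0" using * by (auto simp: qpoch_of_nat)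
  show "qpoch_inf y q \<noteq> 0" using * assms by (subst qpoch_inf_eq_0_iff) auto
qed

lemma qpoch_uminus_nonzero:
  assumes "0 < q" "q < 1" "s > 0"
  shows "1 + of_real s * of_real q ^ n \<noteq> (0::complex)"
    "qpoch (- of_real s) q (int n) \<noteq> 0" "qpoch_inf (- of_real s) q \<noteq> 0"
proof -
  have *: "1 + of_real s * of_real q ^ m \<noteq> (0::complex)" for m :: nat
  proof -
    have "s * q ^ m > 0" using assms by simp
    then have "1 + s * q ^ m \<noteq> 0" by linarith
    moreover have "1 + of_real s * of_real q ^ m = complex_of_real (1 + s * q ^ m)" by simp
    ultimately show ?thesis by (metis of_real_eq_0_iff)
  qed
  show "1 + of_real s * of_real q ^ n \<noteq> (0::complex)" by (rule *)
  show "qpoch (- of_real s) q (int n) \<noteq> 0" using * by (auto simp: qpoch_of_nat)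
  show "qpoch_inf (- of_real s) q \<noteq> 0"
    using * assms by (subst qpoch_inf_eq_0_iff) (auto, metis add.left_inverse)
qed

section \<open>Partial fractions\<close>

text \<open>
  Both sides are rational functions of \<open>t\<close> with the same simple poles, residues and value at
  infinity. Adding one factor at a time avoids polynomials: a product of two simple
  fractions is split into a difference, and the coefficient at the new pole is the old expansion
  evaluated there. This is why the induction leaves \<open>t\<close> arbitrary.
\<close>

lemma prod_linear_fractions_expand:
  fixes c :: "'a \<Rightarrow> 'b :: field" and x t :: 'b
  assumes "finite S" "inj_on c S" "\<And>n. n \<in> S \<Longrightarrow> c n \<noteq> 0"
    "\<And>n. n \<in> S \<Longrightarrow> 1 + t * c n \<noteq> 0"
  shows "(\<Prod>n\<in>S. (1 + t * x * c n) / (1 + t * c n)) =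
     x ^ card S + (\<Sum>k\<in>S. (1 - x) *
        (\<Prod>n\<in>S-{k}. (1 - x * (c n / c k)) / (1 - c n / c k)) / (1 + t * c k))"
  using assms
proof (induction S arbitrary: t rule: finite_induct)
  case empty
  then show ?case by simp
next
  case (insert m S)
  define r where "r k = (1 - x) * (\<Prod>n\<in>S-{k}. (1 - x * (c n / c k)) / (1 - c n / c k))" for k
  define r' where "r' k = (1 - x) * (\<Prod>n\<in>insert m S-{k}. (1 - x * (c n / c k)) / (1 - c n / c k))" for k
  have nz: "c m \<noteq> 0" "1 + t * c m \<noteq> 0" using insert.prems by auto
  have neq: "c k \<noteq> c m" "c k \<noteq> 0" "1 + t * c k \<noteq> 0" "c m \<noteq> c k" if "k \<in> S" for k
    using insert.prems insert.hyps that by (auto simp: inj_on_def)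
  have IH: "(\<Prod>n\<in>S. (1 + u * x * c n) / (1 + u * c n)) = x ^ card S + (\<Sum>k\<in>S. r k / (1 + u * c k))"
    if "\<And>n. n \<in> S \<Longrightarrow> 1 + u * c n \<noteq> 0" for u
    unfolding r_def using insert.IH[of u] insert.prems that by auto
  \<comment> \<open>The residue at the new pole is the old product evaluated at that pole.\<close>
  have r'm: "r' m = (1 - x) * (x ^ card S + (\<Sum>k\<in>S. r k / (1 - c k / c m)))"
  proof -
    have "insert m S - {m} = S" using insert by auto
    then have "r' m = (1 - x) * (\<Prod>n\<in>S. (1 + (- 1 / c m) * x * c n) / (1 + (- 1 / c m) * c n))"
      unfolding r'_def by (simp add: mult_ac)
    also have "\<dots> = (1 - x) * (x ^ card S + (\<Sum>k\<in>S. r k / (1 + (- 1 / c m) * c k)))"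
      by (subst IH) (use neq nz in \<open>auto simp: field_simps\<close>)
    finally show ?thesis by simp
  qed
  have r'k: "r' k = r k * ((1 - x * (c m / c k)) / (1 - c m / c k))" if "k \<in> S" for k
  proof -
    have "insert m S - {k} = insert m (S - {k})" "m \<notin> S - {k}" using insert that by auto
    then show ?thesis unfolding r'_def r_def using insert.hyps(1) by (simp add: mult_ac)
  qed
  have step: "r k / (1 + t * c k) * ((1 + t * x * c m) / (1 + t * c m)) =
      r' k / (1 + t * c k) + (1 - x) * (r k / (1 - c k / c m)) / (1 + t * c m)" if "k \<in> S" for k
  proof -
    have *: "1 / (1 + t * c k) * ((1 + t * x * c m) / (1 + t * c m)) =
      ((1 - x * (c m / c k)) / (1 - c m / c k)) / (1 + t * c k) + (1 - x) * (1 / (1 - c k / c m)) / (1 + t * c m)"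
    proof -
      have d: "c k - c m \<noteq> 0" "c m - c k \<noteq> 0" using neq[OF that] by auto
      have e: "(1 - x * (c m / c k)) / (1 - c m / c k) = (c k - x * c m) / (c k - c m)"
        "1 / (1 - c k / c m) = - c m / (c k - c m)"
        using neq[OF that] nz d by (auto simp: divide_simps) (auto simp: algebra_simps)
      show ?thesis unfolding e
        using neq[OF that] nz d by (simp add: divide_simps) (simp add: algebra_simps)
    qed
    show ?thesis
      using arg_cong[OF *, of "\<lambda>z. r k * z"] unfolding r'k[OF that]
      by (simp add: algebra_simps)
  qed
  have first: "x ^ card S * ((1 + t * x * c m) / (1 + t * c m)) =
      x ^ Suc (card S) + (1 - x) * x ^ card S / (1 + t * c m)"
    using nz by (simp add: field_simps)
  have "(\<Prod>n\<in>insert m S. (1 + t * x * c n) / (1 + t * c n)) =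
      (x ^ card S + (\<Sum>k\<in>S. r k / (1 + t * c k))) * ((1 + t * x * c m) / (1 + t * c m))"
    using insert.hyps IH[of t] neq(3) by (simp add: mult.commute)
  also have "\<dots> = x ^ Suc (card S) + (1 - x) * x ^ card S / (1 + t * c m) +
     (\<Sum>k\<in>S. r' k / (1 + t * c k) + (1 - x) * (r k / (1 - c k / c m)) / (1 + t * c m))"
    unfolding distrib_right first sum_distrib_right
    by (intro arg_cong2[where f="(+)"] refl sum.cong step)
  also have "\<dots> = x ^ Suc (card S) + r' m / (1 + t * c m) + (\<Sum>k\<in>S. r' k / (1 + t * c k))"
    unfolding r'm
    by (simp only: sum.distrib sum_distrib_left sum_divide_distrib distrib_left add_divide_distrib add_ac)
  finally show ?case
    using insert.hyps unfolding r'_def by (simp add: add_ac)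
qed

section \<open>Unordered sums\<close>

text \<open>
  Tannery's theorem for unordered sums: the dominated convergence theorem for counting measure.
\<close>

lemma infsum_tendsto_dominated:
  fixes f :: "nat \<Rightarrow> 'a \<Rightarrow> complex"
  assumes h: "h summable_on A"
    and lim: "\<And>k. k \<in> A \<Longrightarrow> (\<lambda>N. f N k) \<longlonglongrightarrow> g k"
    and bound: "\<And>N k. k \<in> A \<Longrightarrow> norm (f N k) \<le> h k"
  shows "(\<lambda>N. infsum (f N) A) \<longlonglongrightarrow> infsum g A"
proof -
  have h0: "h k \<ge> 0" if "k \<in> A" for k
    using bound[OF that, of 0] norm_ge_zero order_trans by blast
  have "(\<lambda>k. norm (h k)) summable_on A"
    using h by (rule summable_on_cong[THEN iffD1, rotated]) (use h0 in auto)
  then have ih: "integrable (count_space A) h"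
    unfolding abs_summable_equivalent abs_summable_on_def .
  note dc = integrable_dominated_convergence[of g "count_space A" f h]
    integrable_dominated_convergence2[of g "count_space A" f h]
    integral_dominated_convergence[of g "count_space A" f h]
  have "Infinite_Set_Sum.abs_summable_on g A" "Infinite_Set_Sum.abs_summable_on (f N) A" for N
    unfolding abs_summable_equivalent abs_summable_on_def
    using dc(1,2) ih lim bound by (auto simp: AE_count_space)
  moreover have "(\<lambda>N. integral\<^sup>L (count_space A) (f N)) \<longlonglongrightarrow> integral\<^sup>L (count_space A) g"
    using dc(3) ih lim bound by (auto simp: AE_count_space)
  ultimately show ?thesis
    by (simp add: infsetsum_def abs_summable_equivalent flip: infsetsum_infsum)
qed

lemma summable_on_int_if_geometric_bounds:
  fixes f :: "int \<Rightarrow> real"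
  assumes nn: "\<And>k. f k \<ge> 0"
    and pos: "\<And>n. f (int n) \<le> C * r ^ n" and neg: "\<And>n. f (- int n) \<le> D * s ^ n"
    and r: "0 \<le> r" "r < 1" and s: "0 \<le> s" "s < 1"
  shows "f summable_on UNIV"
proof -
  have sm: "g summable_on (UNIV :: nat set)"
    if "\<And>n. 0 \<le> g n" "\<And>n. g n \<le> K * p ^ n" "0 \<le> p" "p < 1" for g :: "nat \<Rightarrow> real" and K p
    using that
    by (subst summable_on_UNIV_nonneg_real_iff)
       (auto intro!: summable_comparison_test'[of "\<lambda>n. K * p ^ n" 0] summable_mult summable_geometric)
  have "f summable_on range int"
    by (subst summable_on_reindex) (auto simp: o_def intro!: sm[of _ C r] nn pos r)
  moreover have "f summable_on range (\<lambda>n. - int n)"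
    by (subst summable_on_reindex) (auto simp: inj_on_def o_def intro!: sm[of _ D s] nn neg s)
  ultimately have "f summable_on (range int \<union> range (\<lambda>n. - int n))"
    by (rule summable_on_union)
  moreover have "range int \<union> range (\<lambda>n. - int n) = UNIV"
    by (auto simp: image_iff) (metis int_cases2)
  ultimately show ?thesis by simp
qed

section \<open>Evaluation of the bilateral series\<close>

lemma prod_symmetric_int_interval:
  fixes g :: "int \<Rightarrow> 'a :: comm_monoid_mult"
  shows "(\<Prod>n\<in>{- int N..<int N}. g n) = (\<Prod>n<N. g (int n) * g (- int (Suc n)))"
proof (induction N)
  case (Suc N)
  have "{- int (Suc N)..<int (Suc N)} = insert (int N) (insert (- int (Suc N)) {- int N..<int N})"
    by auto
  then have "(\<Prod>n\<in>{- int (Suc N)..<int (Suc N)}. g n) =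
      g (int N) * (g (- int (Suc N)) * (\<Prod>n\<in>{- int N..<int N}. g n))"
    by (simp del: of_nat_Suc)
  with Suc show ?case by (simp add: mult_ac)
qed simp

lemma prod_int_interval_without_point:
  fixes g :: "int \<Rightarrow> 'a :: comm_monoid_mult"
  assumes "b = k + int (Suc m)" "a = k - int l"
  shows "(\<Prod>n\<in>{a..<b} - {k}. g n) = (\<Prod>j<m. g (k + int (Suc j))) * (\<Prod>j<l. g (k - int (Suc j)))"
proof -
  have "{a..<b} - {k} = {k+1..<b} \<union> {a..<k}" using assms by auto
  then have "(\<Prod>n\<in>{a..<b} - {k}. g n) = (\<Prod>n\<in>{k+1..<b}. g n) * (\<Prod>n\<in>{a..<k}. g n)"
    by (simp add: prod.union_disjoint)
  also have "(\<Prod>n\<in>{k+1..<b}. g n) = (\<Prod>j<m. g (k + int (Suc j)))"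
    by (rule prod.reindex_bij_witness[of _ "\<lambda>j. k + int (Suc j)" "\<lambda>n. nat (n - k - 1)"])
       (use assms in auto)
  also have "(\<Prod>n\<in>{a..<k}. g n) = (\<Prod>j<l. g (k - int (Suc j)))"
    by (rule prod.reindex_bij_witness[of _ "\<lambda>j. k - int (Suc j)" "\<lambda>n. nat (k - n - 1)"])
       (use assms in auto)
  finally show ?thesis .
qed

lemma one_minus_q_power_nonzero:
  assumes "0 < q" "q < 1"
  shows "1 - complex_of_real q * of_real q ^ j \<noteq> 0"
  using qpoch_nonzero(1)[of q "of_real q" j] assms by simp

text \<open>
  The factors with a negative exponent are turned over with
  \<open>(1 - x / c) / (1 - 1 / c) = x * ((1 - c / x) / (1 - c))\<close>. The powers of \<open>x\<close> released in this way
  are the ones that appear in the bilateral series.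
\<close>

lemma prod_below_eq_qpoch:
  fixes x :: complex
  assumes "0 < q" "q < 1" "x \<noteq> 0"
  shows "(\<Prod>j<l. (1 - x / of_real q ^ Suc j) / (1 - 1 / of_real q ^ Suc j)) =
    x ^ l * (qpoch (of_real q / x) q (int l) / qpoch (of_real q) q (int l))"
proof -
  have "(1 - x / of_real q ^ Suc j) / (1 - 1 / of_real q ^ Suc j) =
      x * ((1 - of_real q / x * of_real q ^ j) / (1 - of_real q * of_real q ^ j))" for j
  proof -
    have "complex_of_real q ^ Suc j \<noteq> 0" "1 - complex_of_real q ^ Suc j \<noteq> 0"
      using assms one_minus_q_power_nonzero[OF assms(1,2), of j] by auto
    moreover have "(1 - x / c) / (1 - 1 / c) = x * ((1 - c / x) / (1 - c))"
      if "c \<noteq> 0" "1 - c \<noteq> 0" for c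
    proof -
      have "c - 1 \<noteq> 0" using that by auto
      then show ?thesis using that assms(3) by (simp add: divide_simps) (simp add: algebra_simps)
    qed
    ultimately show ?thesis by simp
  qed
  then show ?thesis
    by (simp only: prod.distrib prod_dividef qpoch_of_nat prod_constant card_lessThan)
qed

text \<open>
  Since \<open>q\<^sup>n / q\<^sup>k = q\<^sup>n\<^sup>-\<^sup>k\<close>, the coefficient at the pole \<open>k\<close> splits into the factors above and the
  factors below \<open>k\<close>. What remains besides \<open>x\<^sup>N * x\<^sup>k\<close> depends on \<open>k\<close> only through the number of
  these factors, which gives a bound uniform in \<open>k\<close> and \<open>N\<close>.
\<close>

lemma residue_eq_qpoch:
  fixes x :: complex
  assumes q: "0 < q" "q < 1" and x: "x \<noteq> 0" and k: "k \<in> {- int N..<int N}"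
  shows "(1 - x) * (\<Prod>n\<in>{- int N..<int N} - {k}.
        (1 - x * (of_real q powi n / of_real q powi k)) / (1 - of_real q powi n / of_real q powi k)) =
    x ^ N * (x powi k *
      (qpoch x q (int N - k) / qpoch (of_real q) q (int N - k) * (1 - of_real q powi (int N - k))) *
      (qpoch (of_real q / x) q (int N + k) / qpoch (of_real q) q (int N + k)))"
proof -
  define m where "m = nat (int N - k - 1)"
  define l where "l = nat (int N + k)"
  have m: "int N - k = int (Suc m)" and l: "int N + k = int l" using k by (auto simp: m_def l_def)
  let ?Q = "complex_of_real q"
  have Q0: "?Q \<noteq> 0" using q by simp
  have shift: "?Q powi n / ?Q powi k = ?Q powi (n - k)" for n
    using Q0 by (simp add: power_int_diff)
  let ?g = "\<lambda>n. (1 - x * ?Q powi (n - k)) / (1 - ?Q powi (n - k))"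
  have split: "(1 - x) * (\<Prod>n\<in>{- int N..<int N} - {k}. ?g n) =
      (1 - x) * (\<Prod>j<m. ?g (k + int (Suc j))) * (\<Prod>j<l. ?g (k - int (Suc j)))"
    by (subst prod_int_interval_without_point[of _ _ m _ l]) (use m l in auto)
  have "(\<Prod>j<l. ?g (k - int (Suc j))) =
      (\<Prod>j<l. (1 - x / ?Q ^ Suc j) / (1 - 1 / ?Q ^ Suc j))"
    by (intro prod.cong refl) (simp add: power_int_minus divide_inverse flip: of_nat_Suc)
  also have "\<dots> = x ^ l * (qpoch (?Q / x) q (int l) / qpoch ?Q q (int l))"
    by (rule prod_below_eq_qpoch) fact+
  finally have below: "(\<Prod>j<l. ?g (k - int (Suc j))) =
      x ^ l * (qpoch (?Q / x) q (int l) / qpoch ?Q q (int l))" .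
  have above: "(1 - x) * (\<Prod>j<m. ?g (k + int (Suc j))) =
      qpoch x q (int (Suc m)) / qpoch ?Q q (int (Suc m)) * (1 - ?Q ^ Suc m)"
  proof -
    have "(\<Prod>j<m. ?g (k + int (Suc j))) =
       (\<Prod>j<m. 1 - x * ?Q ^ Suc j) / (\<Prod>j<m. 1 - ?Q * ?Q ^ j)"
      unfolding prod_dividef[symmetric]
      by (intro prod.cong refl) (simp flip: of_nat_Suc)
    moreover have "qpoch x q (int (Suc m)) = (1 - x) * (\<Prod>j<m. 1 - x * ?Q ^ Suc j)"
      unfolding qpoch_of_nat by (subst prod.lessThan_Suc_shift) simp
    moreover have "qpoch ?Q q (int (Suc m)) = (\<Prod>j<m. 1 - ?Q * ?Q ^ j) * (1 - ?Q ^ Suc m)"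
      unfolding qpoch_of_nat by simp
    moreover have "1 - ?Q ^ Suc m \<noteq> 0"
      using one_minus_q_power_nonzero[OF q, of m] by simp
    ultimately show ?thesis by simp
  qed
  have "x ^ l = x powi (int N + k)" by (simp only: l power_int_of_nat)
  then have xl: "x ^ l = x ^ N * x powi k"
    using x by (simp add: power_int_add)
  show ?thesis
    unfolding shift split below above m l xl power_int_of_nat by (simp only: mult_ac)
qed

lemma prod_linear_fractions_eq_qpoch:
  fixes x :: complex
  assumes q: "0 < q" "q < 1" and x: "x \<noteq> 0" and t: "t > 0"
  shows "(\<Prod>n\<in>{- int N..<int N}.
        (1 + of_real t * x * of_real q powi n) / (1 + of_real t * of_real q powi n)) =
    x ^ N * (qpoch (- of_real t * x) q (int N) * qpoch (- of_real q / (of_real t * x)) q (int N) /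
      (qpoch (- of_real t) q (int N) * qpoch (- of_real (q / t)) q (int N)))"
proof -
  let ?Q = "complex_of_real q" and ?t = "complex_of_real t"
  have neg: "(1 + ?t * x * ?Q powi - int (Suc n)) / (1 + ?t * ?Q powi - int (Suc n)) =
     x * ((1 - (- ?Q / (?t * x)) * ?Q ^ n) / (1 - (- of_real (q / t)) * ?Q ^ n))" for n
  proof -
    have c: "?Q ^ Suc n \<noteq> 0" "?t \<noteq> 0" using q t by auto
    have d: "1 + ?Q ^ Suc n / ?t \<noteq> 0"
      using qpoch_uminus_nonzero(1)[of q "q / t" n] q t by simp
    have "(1 + s * x * inverse c) / (1 + s * inverse c) = x * ((1 + c / (s * x)) / (1 + c / s))"
      if "c \<noteq> 0" "s \<noteq> 0" "1 + c / s \<noteq> 0" for c s :: complex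
    proof -
      have "c + s \<noteq> 0" "s + c \<noteq> 0" using that by (auto simp: field_simps)
      then show ?thesis using that x by (simp add: divide_simps) (simp add: algebra_simps)
    qed
    from this[OF c d] show ?thesis by (simp add: power_int_minus flip: of_nat_Suc)
  qed
  show ?thesis
    unfolding prod_symmetric_int_interval neg
    by (simp add: prod.distrib prod_dividef qpoch_of_nat)
qed

lemma one_plus_q_powi_ne_0:
  assumes "0 < q" "t > 0"
  shows "1 + of_real t * of_real q powi k \<noteq> (0 :: complex)"
proof -
  have "t * q powi k > 0" using assms by simp
  then have "1 + t * q powi k \<noteq> 0" by linarith
  moreover have "1 + of_real t * of_real q powi k = complex_of_real (1 + t * q powi k)"
    by (simp add: of_real_power_int)
  ultimately show ?thesis by (metis of_real_eq_0_iff)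
qed

text \<open>
  The denominator is at least \<open>1\<close> towards plus infinity, and at least \<open>t * q\<^sup>k\<close> towards minus
  infinity, so that the terms decay like powers of \<open>r\<close> and of \<open>q / r\<close> respectively.
\<close>

lemma summable_kronecker_majorant:
  fixes r :: real
  assumes q: "0 < q" and t: "t > 0" and r: "q < r" "r < 1"
  shows "(\<lambda>k::int. r powi k / (1 + t * q powi k)) summable_on UNIV"
proof (rule summable_on_int_if_geometric_bounds[where C = 1 and r = r and D = "1 / t" and s = "q / r"])
  show "0 \<le> r powi k / (1 + t * q powi k)" for k
    using assms by (intro divide_nonneg_nonneg add_nonneg_nonneg mult_nonneg_nonneg) auto
  show "r powi int n / (1 + t * q powi int n) \<le> 1 * r ^ n" for n
  proof -
    have "1 + t * q ^ n \<ge> 1" using assms by simp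
    moreover have "r ^ n \<ge> 0" using assms by simp
    ultimately show ?thesis
      using mult_left_mono[of 1 "1 + t * q ^ n" "r ^ n"] by (simp add: divide_le_eq)
  qed
  show "r powi (- int n) / (1 + t * q powi (- int n)) \<le> 1 / t * (q / r) ^ n" for n
  proof -
    have p: "q ^ n > 0" "r ^ n > 0" using assms by auto
    have "r powi (- int n) / (1 + t * q powi (- int n)) = (q ^ n / r ^ n) / (q ^ n + t)"
    proof -
      have "inverse b / (1 + t * inverse a) = (a / b) / (a + t)" if "a > 0" "b > 0" for a b
      proof -
        have "a + t \<noteq> 0" "a + t > 0" using that t by linarith+
        then show ?thesis using that t by (simp add: divide_simps)
      qed
      from this[OF p] show ?thesis by (simp add: power_int_minus)
    qed
    also have "\<dots> \<le> (q ^ n / r ^ n) / t"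
      using p t by (intro divide_left_mono) auto
    finally show ?thesis by (simp add: power_divide mult_ac)
  qed
qed (use assms in auto)

lemma norm_kronecker_term:
  assumes "0 < q" "t > 0"
  shows "norm (x powi k / (1 + of_real t * of_real q powi k) :: complex) =
    norm x powi k / (1 + t * q powi k)"
proof -
  have "t * q powi k > 0" using assms by simp
  then have "\<bar>1 + t * q powi k\<bar> = 1 + t * q powi k" by linarith
  moreover have "1 + of_real t * of_real q powi k = complex_of_real (1 + t * q powi k)"
    by (simp add: of_real_power_int)
  ultimately show ?thesis by (simp only: norm_divide norm_power_int norm_of_real)
qed

text \<open>
  The case \<open>\<beta> = \<alpha> * q\<close> of Ramanujan's summation formula, also known as Kronecker's bilateral
  series. In the proof, \<open>T\<close> is the finite product in \<open>t\<close> divided by \<open>x\<^sup>N\<close>, and \<open>A\<close>, \<open>B\<close> are the two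
  q-products in the residues. The remainder \<open>x\<^sup>N\<close>, the value at \<open>t = \<infinity>\<close> after the division, tends
  to \<open>0\<close>.
\<close>

theorem kronecker_series_eq_product:
  fixes x :: complex
  assumes q: "0 < q" "q < 1" and t: "t > 0" and x: "q < norm x" "norm x < 1"
  shows "(\<Sum>\<^sub>\<infinity>k::int. x powi k / (1 + of_real t * of_real q powi k)) =
    (qpoch_inf (- of_real t * x) q * qpoch_inf (- of_real q / (of_real t * x)) q *
       qpoch_inf (of_real q) q ^ 2) /
    (qpoch_inf x q * qpoch_inf (of_real q / x) q *
       qpoch_inf (- of_real (q / t)) q * qpoch_inf (- of_real t) q)"
proof -
  let ?Q = "complex_of_real q" and ?t = "complex_of_real t"
  define A where "A n = qpoch x q (int n) / qpoch ?Q q (int n) * (1 - ?Q ^ n)" for n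
  define B where "B n = qpoch (?Q / x) q (int n) / qpoch ?Q q (int n)" for n
  define T where "T n = qpoch (- ?t * x) q (int n) * qpoch (- ?Q / (?t * x)) q (int n) /
      (qpoch (- ?t) q (int n) * qpoch (- of_real (q / t)) q (int n))" for n
  define f where "f N k = (if k \<in> {- int N..<int N} then x powi k * A (nat (int N - k)) *
      B (nat (int N + k)) / (1 + ?t * ?Q powi k) else 0)" for N :: nat and k :: int
  define A' where "A' = qpoch_inf x q / qpoch_inf ?Q q"
  define B' where "B' = qpoch_inf (?Q / x) q / qpoch_inf ?Q q"
  define T' where "T' = qpoch_inf (- ?t * x) q * qpoch_inf (- ?Q / (?t * x)) q /
      (qpoch_inf (- ?t) q * qpoch_inf (- of_real (q / t)) q)"
  have x0: "x \<noteq> 0" using q x by auto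
  have q': "\<bar>q\<bar> < 1" using q by simp
  have nz: "qpoch_inf ?Q q \<noteq> 0" "qpoch_inf x q \<noteq> 0" "qpoch_inf (?Q / x) q \<noteq> 0"
     "qpoch_inf (- ?t) q \<noteq> 0" "qpoch_inf (- of_real (q / t)) q \<noteq> 0"
    using qpoch_nonzero(3)[OF q, of ?Q] qpoch_nonzero(3)[OF q, of x] qpoch_nonzero(3)[OF q, of "?Q / x"]
      qpoch_uminus_nonzero(3)[OF q, of t] qpoch_uminus_nonzero(3)[OF q, of "q / t"] q x x0 t
    by (simp_all add: norm_divide divide_less_eq)
  note lim = qpoch_tendsto_qpoch_inf[OF q']
  have "(\<lambda>n. A n) \<longlonglongrightarrow> A' * (1 - 0)"
    unfolding A_def A'_def using q
    by (intro tendsto_intros lim nz LIMSEQ_power_zero) auto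
  then have A: "A \<longlonglongrightarrow> A'" by simp
  have B: "B \<longlonglongrightarrow> B'"
    unfolding B_def B'_def by (intro tendsto_intros lim nz)
  have T: "T \<longlonglongrightarrow> T'"
    unfolding T_def T'_def by (intro tendsto_intros lim) (use nz in auto)
  obtain CA CB where CA: "\<And>n. norm (A n) \<le> CA" and CB: "\<And>n. norm (B n) \<le> CB"
    using A B by (meson BseqE convergentI convergent_imp_Bseq)
  \<comment> \<open>The partial fraction expansion, divided by \<open>x\<^sup>N\<close>.\<close>
  have fin: "T N = x ^ N + infsum (f N) UNIV" for N
  proof -
    let ?S = "{- int N..<int N}"
    have inj: "inj_on (\<lambda>k. ?Q powi k) ?S"
    proof (rule inj_onI)
      fix i j :: int assume "?Q powi i = ?Q powi j"
      then have "complex_of_real (q powi i) = complex_of_real (q powi j)"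
        by (simp only: of_real_power_int)
      then have "q powi i = q powi j" by (simp only: of_real_eq_iff)
      then show "i = j" using q
        by (metis less_irrefl not_less_iff_gr_or_eq power_int_strict_decreasing)
    qed
    have "x ^ N * T N = (\<Prod>n\<in>?S. (1 + ?t * x * ?Q powi n) / (1 + ?t * ?Q powi n))"
      unfolding T_def by (rule prod_linear_fractions_eq_qpoch[OF q x0 t, symmetric])
    also have "\<dots> = x ^ card ?S + (\<Sum>k\<in>?S. (1 - x) *
        (\<Prod>n\<in>?S-{k}. (1 - x * (?Q powi n / ?Q powi k)) / (1 - ?Q powi n / ?Q powi k)) /
        (1 + ?t * ?Q powi k))"
      by (rule prod_linear_fractions_expand) (use inj q t one_plus_q_powi_ne_0 in auto)
    also have "\<dots> = x ^ (2 * N) + (\<Sum>k\<in>?S. x ^ N * f N k)"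
    proof (intro arg_cong2[where f = "(+)"] sum.cong refl)
      show "x ^ card ?S = x ^ (2 * N)" by (simp add: nat_mult_distrib)
      fix k assume k: "k \<in> ?S"
      then have "int (nat (int N - k)) = int N - k" "int (nat (int N + k)) = int N + k" by auto
      then show "(1 - x) *
        (\<Prod>n\<in>?S-{k}. (1 - x * (?Q powi n / ?Q powi k)) / (1 - ?Q powi n / ?Q powi k)) /
        (1 + ?t * ?Q powi k) = x ^ N * f N k"
        unfolding residue_eq_qpoch[OF q x0 k] f_def A_def B_def
        using k by (simp add: mult_ac flip: power_int_of_nat)
    qed
    also have "\<dots> = x ^ N * (x ^ N + (\<Sum>k\<in>?S. f N k))"
      by (simp add: sum_distrib_left ring_distribs mult_2 power_add)
    also have "(\<Sum>k\<in>?S. f N k) = infsum (f N) ?S" by simp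
    also have "\<dots> = infsum (f N) UNIV"
      by (rule infsum_cong_neutral) (auto simp: f_def)
    finally show ?thesis using x0 by simp
  qed
  have "(\<lambda>N. infsum (f N) UNIV) \<longlonglongrightarrow>
     (\<Sum>\<^sub>\<infinity>k. A' * B' * (x powi k / (1 + ?t * ?Q powi k)))"
  proof (rule infsum_tendsto_dominated)
    show "(\<lambda>k. CA * CB * (norm x powi k / (1 + t * q powi k))) summable_on UNIV"
      by (intro summable_on_cmult_right summable_kronecker_majorant q t x)
    fix k :: int
    have p: "filterlim (\<lambda>N. nat (int N + j)) at_top sequentially" for j
      unfolding filterlim_at_top
    proof
      fix Z
      show "\<forall>\<^sub>F N in sequentially. Z \<le> nat (int N + j)"
        using eventually_ge_at_top[of "Z + nat \<bar>j\<bar>"] by eventually_elim auto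
    qed
    have AN: "(\<lambda>N. A (nat (int N - k))) \<longlonglongrightarrow> A'" and BN: "(\<lambda>N. B (nat (int N + k))) \<longlonglongrightarrow> B'"
      using filterlim_compose[OF A p[of "- k"]] filterlim_compose[OF B p[of k]] by simp_all
    have "(\<lambda>N. x powi k * A (nat (int N - k)) * B (nat (int N + k)) / (1 + ?t * ?Q powi k))
      \<longlonglongrightarrow> x powi k * A' * B' / (1 + ?t * ?Q powi k)"
      by (intro tendsto_intros AN BN one_plus_q_powi_ne_0 q t)
    moreover have "\<forall>\<^sub>F N in sequentially. f N k =
        x powi k * A (nat (int N - k)) * B (nat (int N + k)) / (1 + ?t * ?Q powi k)"
      using eventually_gt_at_top[of "nat \<bar>k\<bar>"] by eventually_elim (auto simp: f_def)
    ultimately show "(\<lambda>N. f N k) \<longlonglongrightarrow> A' * B' * (x powi k / (1 + ?t * ?Q powi k))"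
      by (simp add: tendsto_cong mult_ac)
    fix N
    have "0 \<le> CA" "0 \<le> CB" using CA[of 0] CB[of 0] by (auto intro: order_trans[OF norm_ge_zero])
    then have bd: "norm (A m) * norm (B n) * norm (x powi k / (1 + ?t * ?Q powi k)) \<le>
        CA * CB * norm (x powi k / (1 + ?t * ?Q powi k))" for m n
      by (intro mult_right_mono mult_mono CA CB) auto
    have "norm (f N k) \<le> CA * CB * norm (x powi k / (1 + ?t * ?Q powi k))"
      using bd[of "nat (int N - k)" "nat (int N + k)"] \<open>0 \<le> CA\<close> \<open>0 \<le> CB\<close>
      unfolding f_def by (auto simp: norm_mult norm_divide mult_ac)
    then show "norm (f N k) \<le> CA * CB * (norm x powi k / (1 + t * q powi k))"
      using q t by (simp only: norm_kronecker_term)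
  qed
  then have "(\<lambda>N. x ^ N + infsum (f N) UNIV) \<longlonglongrightarrow>
      0 + (\<Sum>\<^sub>\<infinity>k. A' * B' * (x powi k / (1 + ?t * ?Q powi k)))"
    using x by (intro tendsto_add LIMSEQ_power_zero) auto
  then have "T' = (\<Sum>\<^sub>\<infinity>k. A' * B' * (x powi k / (1 + ?t * ?Q powi k)))"
    using T by (simp add: LIMSEQ_unique flip: fin)
  also have "\<dots> = A' * B' * (\<Sum>\<^sub>\<infinity>k. x powi k / (1 + ?t * ?Q powi k))"
    by (rule infsum_cmult_right')
  finally have "(\<Sum>\<^sub>\<infinity>k. x powi k / (1 + ?t * ?Q powi k)) = T' / (A' * B')"
    using nz by (simp add: A'_def B'_def)
  then show ?thesis
    unfolding T'_def A'_def B'_def using nz by (simp add: power2_eq_square mult_ac)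
qed

section \<open>The weighted Szego kernel\<close>

text \<open>
  Passing from \<open>- t\<close> to \<open>- t * q\<close> shifts the factors of the product by one, so all but the two
  extreme factors cancel.
\<close>

lemma qpoch_ratio_shift:
  assumes q: "0 < q" "q < 1" and t: "t > 0"
  shows "qpoch (- of_real t) q n / qpoch (- of_real (t * q)) q n =
    (1 + of_real t) / (1 + of_real t * of_real q powi n)"
proof (cases "n \<ge> 0")
  case True
  then obtain m where n: "n = int m" using zero_le_imp_eq_int by blast
  have nz: "qpoch (- of_real (t * q)) q (int m) \<noteq> 0" for m
    using qpoch_uminus_nonzero(2)[OF q, of "t * q" m] q t by simp
  have "qpoch (- of_real t) q (int m) * (1 + of_real t * of_real q ^ m) =
      (1 + of_real t) * qpoch (- of_real (t * q)) q (int m)"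
  proof -
    have "qpoch (- of_real t) q (int (Suc m)) =
        (1 + of_real t) * qpoch (- of_real (t * q)) q (int m)"
      unfolding qpoch_of_nat by (subst prod.lessThan_Suc_shift) (simp add: mult_ac)
    moreover have "qpoch (- of_real t) q (int (Suc m)) =
        qpoch (- of_real t) q (int m) * (1 + of_real t * of_real q ^ m)"
      unfolding qpoch_of_nat by simp
    ultimately show ?thesis by simp
  qed
  then show ?thesis
    using nz[of m] one_plus_q_powi_ne_0[OF q(1) t, of n] unfolding n by (simp add: frac_eq_eq)
next
  case False
  define m where "m = nat (- n)"
  have m: "n = - int m" "m > 0" using False by (auto simp: m_def)
  let ?Q = "complex_of_real q" and ?t = "complex_of_real t"
  define u where "u k = 1 + ?t * ?Q powi (- int k)" for k
  have u0: "u k \<noteq> 0" for k unfolding u_def by (rule one_plus_q_powi_ne_0) fact+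
  have "qpoch (- ?t) q n = (\<Prod>k=1..m. inverse (u k))"
    unfolding qpoch_def u_def using m by simp
  also have "{1..m} = Suc ` {..<m}" by (auto simp: image_iff Suc_le_eq gr0_conv_Suc)
  also have "(\<Prod>k\<in>Suc ` {..<m}. inverse (u k)) = (\<Prod>k<m. inverse (u (Suc k)))"
    by (simp add: prod.reindex)
  finally have num: "qpoch (- ?t) q n = (\<Prod>k<m. inverse (u (Suc k)))" .
  have "qpoch (- of_real (t * q)) q n = (\<Prod>k=1..m. inverse (u (k - 1)))"
    unfolding qpoch_def u_def using m q
    by (auto intro!: prod.cong simp: power_int_minus gr0_conv_Suc Suc_le_eq)
  also have "{1..m} = Suc ` {..<m}" by (auto simp: image_iff Suc_le_eq gr0_conv_Suc)
  also have "(\<Prod>k\<in>Suc ` {..<m}. inverse (u (k - 1))) = (\<Prod>k<m. inverse (u k))"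
    by (simp add: prod.reindex)
  finally have den: "qpoch (- of_real (t * q)) q n = (\<Prod>k<m. inverse (u k))" .
  have "qpoch (- ?t) q n / qpoch (- of_real (t * q)) q n = (\<Prod>k<m. u k / u (Suc k))"
    unfolding num den prod_dividef[symmetric]
    by (intro prod.cong refl) (simp add: field_simps)
  also have "\<dots> = u 0 / u m"
    by (induction m) (use u0 in auto)
  finally show ?thesis unfolding u_def m by simp
qed

text \<open>
  Taking \<open>x\<close> out of the two factors that are not yet of the form \<open>1 - y * q\<^sup>n\<close> cancels it, and
  the product becomes a quotient of convergent q-products.
\<close>

lemma szego_factor_eq:
  fixes \<rho> t a z
  defines "x \<equiv> cnj a * z" and "q \<equiv> \<rho>\<^sup>2"
  assumes "0 < \<rho>" "t > 0" "x \<noteq> 0"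
  shows "szego_factor \<rho> t z a n =
    ((1 - (- of_real t * x) * of_real q ^ n) * (1 - (- of_real q / (of_real t * x)) * of_real q ^ n) *
       (1 - of_real q * of_real q ^ n) ^ 2) /
    ((1 - x * of_real q ^ n) * (1 - of_real q / x * of_real q ^ n) *
       (1 - (- of_real (q / t)) * of_real q ^ n) * (1 - (- of_real t) * of_real q ^ n))"
proof -
  have p: "complex_of_real \<rho> ^ (2 * n) = of_real q ^ n" by (simp add: q_def power_mult)
  have p2: "complex_of_real \<rho> ^ (2 * n + 2) = of_real q * of_real q ^ n"
    by (simp add: p power_add) (simp add: q_def power2_eq_square)
  have e1: "x + c / of_real t = x * (1 + c / (of_real t * x))"
    and e2: "x - c = x * (1 - c / x)" for c
    using assms by (auto simp: field_simps)
  show ?thesis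
    unfolding szego_factor_def p p2 x_def[symmetric] mult.assoc[of _ "cnj a" z] e1 e2
    using \<open>x \<noteq> 0\<close> by (simp add: mult_ac)
qed

lemma szego_product:
  fixes \<rho> t a z
  defines "x \<equiv> cnj a * z" and "q \<equiv> \<rho>\<^sup>2"
  assumes \<rho>: "0 < \<rho>" "\<rho> < 1" and t: "t > 0" and x: "x \<noteq> 0"
  shows "convergent_prod (szego_factor \<rho> t z a)"
    and "(\<Prod>n. szego_factor \<rho> t z a n) =
    (qpoch_inf (- of_real t * x) q * qpoch_inf (- of_real q / (of_real t * x)) q *
       qpoch_inf (of_real q) q ^ 2) /
    (qpoch_inf x q * qpoch_inf (of_real q / x) q *
       qpoch_inf (- of_real (q / t)) q * qpoch_inf (- of_real t) q)"
proof -
  have q: "\<bar>q\<bar> < 1" unfolding q_def using \<rho> by (simp add: abs_square_less_1)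
  have hp: "(\<lambda>n. 1 - y * of_real q ^ n) has_prod qpoch_inf y q" for y
    unfolding qpoch_inf_def using convergent_prod_qpoch_factors[OF q] by blast
  have "szego_factor \<rho> t z a has_prod
    ((qpoch_inf (- of_real t * x) q * qpoch_inf (- of_real q / (of_real t * x)) q *
       qpoch_inf (of_real q) q ^ 2) /
    (qpoch_inf x q * qpoch_inf (of_real q / x) q *
       qpoch_inf (- of_real (q / t)) q * qpoch_inf (- of_real t) q))"
    unfolding szego_factor_eq[OF \<rho>(1) t x[unfolded x_def], folded x_def q_def, abs_def] power2_eq_square
    by (intro has_prod_divide has_prod_mult hp)
  then show "convergent_prod (szego_factor \<rho> t z a)"
    and "(\<Prod>n. szego_factor \<rho> t z a n) =
    (qpoch_inf (- of_real t * x) q * qpoch_inf (- of_real q / (of_real t * x)) q *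
       qpoch_inf (of_real q) q ^ 2) /
    (qpoch_inf x q * qpoch_inf (of_real q / x) q *
       qpoch_inf (- of_real (q / t)) q * qpoch_inf (- of_real t) q)"
    by (auto simp: has_prod_iff)
qed

lemma szego_term_eq:
  "szego_term \<rho> t z a k = (cnj a * z) powi k / (1 + of_real t * of_real (\<rho>\<^sup>2) powi k)"
  by (simp add: szego_term_def power_int_mult)

lemma psi11_term_eq:
  assumes "0 < \<rho>" "\<rho> < 1" "t > 0"
  shows "psi11_term (- of_real t) (- of_real (t * \<rho>\<^sup>2)) (\<rho>\<^sup>2) (cnj a * z) k =
    (1 + of_real t) * szego_term \<rho> t z a k"
proof -
  have "0 < \<rho>\<^sup>2" "\<rho>\<^sup>2 < 1" using assms by (simp_all add: power_less_one_iff)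
  then show ?thesis
    unfolding psi11_term_def szego_term_eq by (simp only: qpoch_ratio_shift assms) simp
qed

lemma norm_cnj_mult_annulus:
  assumes "0 < \<rho>" "\<rho> < 1" "a \<in> annulus \<rho>" "z \<in> annulus \<rho> \<union> annulus_boundary \<rho>"
  shows "\<rho>\<^sup>2 < norm (cnj a * z)" "norm (cnj a * z) < 1"
proof -
  have a: "\<rho> < norm a" "norm a < 1" and z: "\<rho> \<le> norm z" "norm z \<le> 1"
    using assms by (auto simp: annulus_def annulus_boundary_def)
  have "\<rho> * \<rho> < norm a * norm z"
    using a z assms by (intro mult_less_le_imp_less) auto
  then show "\<rho>\<^sup>2 < norm (cnj a * z)" by (simp add: norm_mult power2_eq_square)
  have "norm a * norm z \<le> norm a * 1" using z by (intro mult_left_mono) auto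
  with a show "norm (cnj a * z) < 1" by (simp add: norm_mult)
qed

lemma szego_representations:
  assumes \<rho>: "0 < \<rho>" "\<rho> < 1" and t: "t > 0"
    and a: "a \<in> annulus \<rho>" and z: "z \<in> annulus \<rho> \<union> annulus_boundary \<rho>"
  shows "szego_term \<rho> t z a summable_on UNIV"
    and "psi11_term (- of_real t) (- of_real (t * \<rho>^2)) (\<rho>^2) (cnj a * z) summable_on UNIV"
    and "szego \<rho> t z a = 1 / (2 * of_real pi * (1 + of_real t))
            * psi11 (- of_real t) (- of_real (t * \<rho>^2)) (\<rho>^2) (cnj a * z)"
    and "szego \<rho> t z a = 1 / (2 * of_real pi) * (\<Prod>n. szego_factor \<rho> t z a n)"
proof -
  note x = norm_cnj_mult_annulus[OF \<rho> a z]
  have q: "0 < \<rho>\<^sup>2" "\<rho>\<^sup>2 < 1" using \<rho> by (simp_all add: power_less_one_iff)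
  have x0: "cnj a * z \<noteq> 0" using x q by auto
  have "(\<lambda>k. norm (szego_term \<rho> t z a k)) summable_on UNIV"
    unfolding szego_term_eq norm_kronecker_term[OF q(1) t]
    by (rule summable_kronecker_majorant[OF q(1) t x])
  then show s: "szego_term \<rho> t z a summable_on UNIV"
    by (rule abs_summable_summable)
  note ps = psi11_term_eq[OF \<rho> t, of a z, abs_def]
  show "psi11_term (- of_real t) (- of_real (t * \<rho>^2)) (\<rho>^2) (cnj a * z) summable_on UNIV"
    unfolding ps by (intro summable_on_cmult_right s)
  have "1 + complex_of_real t \<noteq> 0"
    using one_plus_q_powi_ne_0[OF q(1) t, of 0] by simp
  then show "szego \<rho> t z a = 1 / (2 * of_real pi * (1 + of_real t))
            * psi11 (- of_real t) (- of_real (t * \<rho>^2)) (\<rho>^2) (cnj a * z)"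
    unfolding szego_def psi11_def ps infsum_cmult_right' by simp
  show "szego \<rho> t z a = 1 / (2 * of_real pi) * (\<Prod>n. szego_factor \<rho> t z a n)"
    unfolding szego_def szego_term_eq szego_product(2)[OF \<rho> t x0]
    by (subst kronecker_series_eq_product[OF q t x]) simp
qed

section \<open>Zeros\<close>

lemma ex_int_iff_nat:
  "(\<exists>k::int. P k) \<longleftrightarrow> (\<exists>n. P (- int n)) \<or> (\<exists>n. P (int (Suc n)))"
proof -
  have "k = - int (nat (- k)) \<or> k = int (Suc (nat (k - 1)))" for k by linarith
  then show ?thesis by metis
qed

lemma szego_eq_0_iff:
  assumes \<rho>: "0 < \<rho>" "\<rho> < 1" and t: "t > 0" and a: "a \<in> annulus \<rho>" and z: "z \<in> annulus \<rho>"
  shows "szego \<rho> t z a = 0 \<longleftrightarrow> (\<exists>k::int. cnj a * z = - of_real (\<rho> powi (2 * k) / t))"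
proof -
  have z': "z \<in> annulus \<rho> \<union> annulus_boundary \<rho>" using z by blast
  note x = norm_cnj_mult_annulus[OF \<rho> a z']
  have q: "0 < \<rho>\<^sup>2" "\<rho>\<^sup>2 < 1" using \<rho> by (simp_all add: power_less_one_iff)
  have q': "\<bar>\<rho>\<^sup>2\<bar> < 1" using q by simp
  let ?x = "cnj a * z" and ?Q = "complex_of_real (\<rho>\<^sup>2)" and ?t = "complex_of_real t"
  have x0: "?x \<noteq> 0" using x q by auto
  have Qn: "?Q ^ n \<noteq> 0" for n using q by simp
  have t0: "?t \<noteq> 0" using t by simp
  have nz: "qpoch_inf ?Q (\<rho>\<^sup>2) \<noteq> 0" "qpoch_inf ?x (\<rho>\<^sup>2) \<noteq> 0" "qpoch_inf (?Q / ?x) (\<rho>\<^sup>2) \<noteq> 0"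
     "qpoch_inf (- ?t) (\<rho>\<^sup>2) \<noteq> 0" "qpoch_inf (- of_real (\<rho>\<^sup>2 / t)) (\<rho>\<^sup>2) \<noteq> 0"
    using qpoch_nonzero(3)[OF q, of ?Q] qpoch_nonzero(3)[OF q, of ?x]
      qpoch_nonzero(3)[OF q, of "?Q / ?x"] qpoch_uminus_nonzero(3)[OF q, of t]
      qpoch_uminus_nonzero(3)[OF q, of "\<rho>\<^sup>2 / t"] q x x0 t
    by (simp_all add: norm_divide divide_less_eq norm_mult norm_power)
  have "szego \<rho> t z a = 0 \<longleftrightarrow>
     qpoch_inf (- ?t * ?x) (\<rho>\<^sup>2) = 0 \<or> qpoch_inf (- ?Q / (?t * ?x)) (\<rho>\<^sup>2) = 0"
    unfolding szego_representations(4)[OF \<rho> t a z'] szego_product(2)[OF \<rho> t x0]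
    using nz by simp
  also have "\<dots> \<longleftrightarrow> (\<exists>n. - ?t * ?x * ?Q ^ n = 1) \<or> (\<exists>n. - ?Q / (?t * ?x) * ?Q ^ n = 1)"
    unfolding qpoch_inf_eq_0_iff[OF q'] ..
  also have "\<dots> \<longleftrightarrow> (\<exists>n. ?x = - (?Q powi (- int n) / ?t)) \<or> (\<exists>n. ?x = - (?Q powi int (Suc n) / ?t))"
  proof -
    have "- ?t * ?x * ?Q ^ n = 1 \<longleftrightarrow> ?x = - (?Q powi (- int n) / ?t)" for n
    proof -
      have "- s * y * c = 1 \<longleftrightarrow> y = - (inverse c / s)" if "c \<noteq> 0" "s \<noteq> 0" for c s y :: complex
      proof -
        have "- s * y * c = 1 \<longleftrightarrow> y * (s * c) = - 1"
          by (subst minus_minus[symmetric, of "- s * y * c"], subst neg_equal_iff_equal[symmetric])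
             (simp add: mult_ac)
        also have "\<dots> \<longleftrightarrow> y = - 1 / (s * c)"
          using that by (subst eq_divide_eq) simp
        finally show ?thesis using that by (simp add: field_simps)
      qed
      from this[OF Qn t0, of ?x] show ?thesis by (simp add: power_int_minus)
    qed
    moreover have "- ?Q / (?t * ?x) * ?Q ^ n = 1 \<longleftrightarrow> ?x = - (?Q powi int (Suc n) / ?t)" for n
    proof -
      have "- c / (s * y) * d = 1 \<longleftrightarrow> y = - (c * d / s)" if "y \<noteq> 0" "s \<noteq> 0" for c d s y :: complex
        using that by (auto simp: field_simps)
      from this[OF x0 t0, of ?Q "?Q ^ n"] show ?thesis by (simp flip: of_nat_Suc)
    qed
    ultimately show ?thesis by simp
  qed
  also have "\<dots> \<longleftrightarrow> (\<exists>k::int. ?x = - (?Q powi k / ?t))"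
    by (rule ex_int_iff_nat[symmetric])
  also have "(\<lambda>k. ?Q powi k / ?t) = (\<lambda>k. of_real (\<rho> powi (2 * k) / t))"
    by (simp add: power_int_mult fun_eq_iff of_real_power_int)
  finally show ?thesis .
qed

lemma power_int_less_imp_exponent_greater:
  fixes \<rho> :: real
  assumes "0 < \<rho>" "\<rho> < 1" "\<rho> powi i < \<rho> powi j"
  shows "j < i"
proof (rule ccontr)
  assume "\<not> j < i"
  then have "\<rho> powi j \<le> \<rho> powi i"
    using assms by (intro power_int_decreasing) auto
  with assms show False by simp
qed

text \<open>
  For \<open>norm a = r\<close> a zero requires some \<open>s k\<close>, the modulus of a possible zero of the product in \<open>x\<close>,
  between \<open>\<rho> * r\<close> and \<open>r\<close>. The choice \<open>r = sqrt \<rho>\<close> yields an \<open>s k\<close> between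
  \<open>\<rho>\<^sup>2\<close> and \<open>1\<close>. If it is not \<open>\<rho>\<close>, then \<open>r\<close> can be chosen so that \<open>s k\<close> is an excluded end point of
  the interval, as the upper end if \<open>s k > \<rho>\<close> and as the lower end if \<open>s k < \<rho>\<close>. The neighbours of
  \<open>s k\<close> are too far away to lie in the interval.
\<close>

lemma zero_for_every_base_point_imp_odd_power:
  assumes \<rho>: "0 < \<rho>" "\<rho> < 1" and t: "t > 0"
    and ex: "\<And>a. a \<in> annulus \<rho> \<Longrightarrow> \<exists>z\<in>annulus \<rho>. szego \<rho> t z a = 0"
  shows "\<exists>k::int. t = \<rho> powi (2 * k - 1)"
proof -
  define s where "s k = \<rho> powi (2 * k) / t" for k :: int
  have s0: "s k > 0" for k using \<rho> t by (simp add: s_def)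
  have window: "\<exists>k. \<rho> * r < s k \<and> s k < r" if r: "\<rho> < r" "r < 1" for r
  proof -
    have ra: "complex_of_real r \<in> annulus \<rho>" using r \<rho> by (simp add: annulus_def)
    obtain z where z: "z \<in> annulus \<rho>" "szego \<rho> t z (of_real r) = 0" using ex[OF ra] by blast
    then obtain k where "cnj (of_real r) * z = - of_real (s k)"
      unfolding szego_eq_0_iff[OF \<rho> t ra z(1)] s_def by blast
    then have "norm (cnj (of_real r) * z) = s k" using s0[of k] by simp
    then have "s k = r * norm z" using r \<rho> by (simp add: norm_mult)
    moreover have "\<rho> * r < r * norm z" "r * norm z < r"
      using z r \<rho> by (auto simp: annulus_def)
    ultimately show ?thesis by metis
  qed
  have spacing: "j = k" if "\<rho>\<^sup>2 * s k < s j" "\<rho>\<^sup>2 * s j < s k" for j k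
  proof -
    have "\<rho>\<^sup>2 * s i = s (i + 1)" for i
      using \<rho> by (simp add: s_def power_int_add distrib_left)
    with that have "\<rho> powi (2 * (k + 1)) < \<rho> powi (2 * j)" "\<rho> powi (2 * (j + 1)) < \<rho> powi (2 * k)"
      using t by (auto simp: s_def divide_less_cancel)
    then have "2 * j < 2 * (k + 1)" "2 * k < 2 * (j + 1)"
      by (auto dest!: power_int_less_imp_exponent_greater[OF \<rho>])
    then show "j = k" by presburger
  qed
  have sq: "\<rho> < sqrt \<rho>" "sqrt \<rho> < 1"
    using \<rho> by (auto simp: real_less_rsqrt power2_eq_square)
  obtain k where k: "\<rho> * sqrt \<rho> < s k" "s k < sqrt \<rho>" using window[OF sq] by blast
  have "\<rho> * \<rho> < \<rho> * sqrt \<rho>" using sq \<rho> by simp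
  with k sq have k': "\<rho> * \<rho> < s k" "s k < 1" by linarith+
  have "s k = \<rho>"
  proof (rule ccontr)
    assume "s k \<noteq> \<rho>"
    then consider "s k > \<rho>" | "s k < \<rho>" by linarith
    then show False
    proof cases
      case 1
      obtain j where j: "\<rho> * s k < s j" "s j < s k" using window[of "s k"] 1 k' by blast
      have "j = k"
      proof (rule spacing)
        have "\<rho>\<^sup>2 * s k \<le> \<rho> * s k"
          using \<rho> s0[of k] by (simp add: power2_eq_square)
        then show "\<rho>\<^sup>2 * s k < s j" using j by linarith
        have "\<rho>\<^sup>2 * s j \<le> 1 * s j"
          using \<rho> s0[of j] by (intro mult_right_mono) (auto simp: power_le_one)
        then show "\<rho>\<^sup>2 * s j < s k" using j by linarith
      qed
      with j show False by simp
    next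
      case 2
      have r: "\<rho> < s k / \<rho>" "s k / \<rho> < 1" using 2 k' \<rho> by (auto simp: field_simps)
      obtain j where j: "\<rho> * (s k / \<rho>) < s j" "s j < s k / \<rho>" using window[OF r] by blast
      have j': "s k < s j" "\<rho> * s j < s k" using j \<rho> by (auto simp: field_simps)
      have "j = k"
      proof (rule spacing)
        have "\<rho>\<^sup>2 * s k \<le> 1 * s k"
          using \<rho> s0[of k] by (intro mult_right_mono) (auto simp: power_le_one)
        then show "\<rho>\<^sup>2 * s k < s j" using j' by linarith
        have "\<rho>\<^sup>2 * s j \<le> \<rho> * s j"
          using \<rho> s0[of j] by (simp add: power2_eq_square)
        then show "\<rho>\<^sup>2 * s j < s k" using j' by linarith
      qed
      with j' show False by simp
    qed
  qed
  then have "t = \<rho> powi (2 * k - 1)"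
    using \<rho> t by (simp add: s_def power_int_diff field_simps)
  then show ?thesis ..
qed

text \<open>
  The possible moduli of \<open>x\<close> are now the odd powers of \<open>\<rho>\<close>, and \<open>\<rho>\<close> is the only one of them between
  \<open>\<rho>\<^sup>2\<close> and \<open>1\<close>.
\<close>

lemma szego_zeros_odd_power:
  assumes \<rho>: "0 < \<rho>" "\<rho> < 1" and t: "t = \<rho> powi (2 * k - 1)" and a: "a \<in> annulus \<rho>"
  shows "{z \<in> annulus \<rho>. szego \<rho> t z a = 0} = {- of_real \<rho> / cnj a}"
proof -
  have t0: "t > 0" using \<rho> t by simp
  have a': "\<rho> < norm a" "norm a < 1" "a \<noteq> 0" using a \<rho> by (auto simp: annulus_def)
  have pw: "\<rho> powi (2 * j) / t = \<rho> powi (2 * (j - k) + 1)" for j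
    unfolding t using \<rho> by (simp flip: power_int_diff add: algebra_simps)
  have iff: "szego \<rho> t z a = 0 \<longleftrightarrow> cnj a * z = - of_real \<rho>" if z: "z \<in> annulus \<rho>" for z
  proof
    assume "szego \<rho> t z a = 0"
    then obtain j where j: "cnj a * z = - of_real (\<rho> powi (2 * (j - k) + 1))"
      unfolding szego_eq_0_iff[OF \<rho> t0 a z] pw by blast
    then have "norm (cnj a * z) = \<rho> powi (2 * (j - k) + 1)"
      using \<rho> by (simp only: norm_minus_cancel norm_of_real) simp
    then have "\<rho> powi 2 < \<rho> powi (2 * (j - k) + 1)" "\<rho> powi (2 * (j - k) + 1) < \<rho> powi 0"
      using norm_cnj_mult_annulus[OF \<rho> a, of z] z by auto
    then have "2 * (j - k) + 1 < 2" "0 < 2 * (j - k) + 1"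
      by (blast dest: power_int_less_imp_exponent_greater[OF \<rho>])+
    then have "2 * (j - k) + 1 = 1" by linarith
    then show "cnj a * z = - of_real \<rho>" using j by simp
  next
    assume "cnj a * z = - of_real \<rho>"
    then have "cnj a * z = - of_real (\<rho> powi (2 * k) / t)" unfolding pw by simp
    then show "szego \<rho> t z a = 0" unfolding szego_eq_0_iff[OF \<rho> t0 a z] by blast
  qed
  have "\<rho> < \<rho> / norm a" "\<rho> / norm a < 1"
    using a' \<rho> by (auto simp: less_divide_eq divide_less_eq)
  then have "- of_real \<rho> / cnj a \<in> annulus \<rho>"
    using \<rho> by (simp add: annulus_def norm_divide)
  moreover have "cnj a * z = - of_real \<rho> \<longleftrightarrow> z = - of_real \<rho> / cnj a" for z
    using a' by (auto simp: field_simps)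
  ultimately show ?thesis using iff by auto
qed

lemma odd_int_cases:
  "(\<exists>k::int. t = f (2 * k - 1)) \<longleftrightarrow>
   (\<exists>m::nat. t = f (2 * int m + 1) \<or> t = f (- (2 * int m + 1)))"
proof
  assume "\<exists>k::int. t = f (2 * k - 1)"
  then obtain k :: int where k: "t = f (2 * k - 1)" ..
  show "\<exists>m::nat. t = f (2 * int m + 1) \<or> t = f (- (2 * int m + 1))"
  proof (cases "k \<ge> 1")
    case True
    then have "2 * k - 1 = 2 * int (nat (k - 1)) + 1" by simp
    with k show ?thesis by metis
  next
    case False
    then have "2 * k - 1 = - (2 * int (nat (- k)) + 1)" by simp
    with k show ?thesis by metis
  qed
next
  assume "\<exists>m::nat. t = f (2 * int m + 1) \<or> t = f (- (2 * int m + 1))"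
  then obtain m :: nat where "t = f (2 * int m + 1) \<or> t = f (- (2 * int m + 1))" ..
  moreover have "2 * int m + 1 = 2 * (int m + 1) - 1" "- (2 * int m + 1) = 2 * (- int m) - 1" by simp_all
  ultimately show "\<exists>k::int. t = f (2 * k - 1)" by metis
qed

theorem theorem3:
  fixes \<rho> t :: real
  assumes "0 < \<rho>" and "\<rho> < 1" and "t > 0"
  shows
    "(\<forall>a \<in> annulus \<rho>. \<forall>z \<in> annulus \<rho> \<union> annulus_boundary \<rho>.
        szego_term \<rho> t z a summable_on UNIV
      \<and> psi11_term (- of_real t) (- of_real (t * \<rho>^2)) (\<rho>^2) (cnj a * z) summable_on UNIV
      \<and> convergent_prod (szego_factor \<rho> t z a)
      \<and> szego \<rho> t z a =
          1 / (2 * of_real pi * (1 + of_real t))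
            * psi11 (- of_real t) (- of_real (t * \<rho>^2)) (\<rho>^2) (cnj a * z)
      \<and> szego \<rho> t z a = 1 / (2 * of_real pi) * (\<Prod>n. szego_factor \<rho> t z a n))
     \<and> ((\<forall>a \<in> annulus \<rho>. \<exists>z \<in> annulus \<rho>. szego \<rho> t z a = 0) \<longrightarrow>
          (\<exists>m::nat. t = \<rho> powi (2 * int m + 1) \<or> t = \<rho> powi (- (2 * int m + 1))))
     \<and> (\<forall>m::nat. t = \<rho> powi (2 * int m + 1) \<or> t = \<rho> powi (- (2 * int m + 1)) \<longrightarrow>
          (\<forall>a \<in> annulus \<rho>. {z \<in> annulus \<rho>. szego \<rho> t z a = 0} = {- of_real \<rho> / cnj a}))"
proof (intro conjI ballI allI impI)
  fix a z assume az: "a \<in> annulus \<rho>" "z \<in> annulus \<rho> \<union> annulus_boundary \<rho>"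
  note rep = szego_representations[OF assms az]
  show "szego_term \<rho> t z a summable_on UNIV"
    by (rule rep)
  show "psi11_term (- of_real t) (- of_real (t * \<rho>^2)) (\<rho>^2) (cnj a * z) summable_on UNIV"
    by (rule rep)
  show "szego \<rho> t z a = 1 / (2 * of_real pi * (1 + of_real t))
            * psi11 (- of_real t) (- of_real (t * \<rho>^2)) (\<rho>^2) (cnj a * z)"
    by (rule rep)
  show "szego \<rho> t z a = 1 / (2 * of_real pi) * (\<Prod>n. szego_factor \<rho> t z a n)"
    by (rule rep)
  have "cnj a * z \<noteq> 0"
    using norm_cnj_mult_annulus(1)[OF assms(1,2) az] by auto
  then show "convergent_prod (szego_factor \<rho> t z a)"
    by (rule szego_product(1)[OF assms])
next
  assume "\<forall>a \<in> annulus \<rho>. \<exists>z \<in> annulus \<rho>. szego \<rho> t z a = 0"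
  then have "\<exists>k::int. t = \<rho> powi (2 * k - 1)"
    by (intro zero_for_every_base_point_imp_odd_power[OF assms]) simp
  then show "\<exists>m::nat. t = \<rho> powi (2 * int m + 1) \<or> t = \<rho> powi (- (2 * int m + 1))"
    by (rule odd_int_cases[THEN iffD1])
next
  fix m :: nat and a
  assume "t = \<rho> powi (2 * int m + 1) \<or> t = \<rho> powi (- (2 * int m + 1))" and a: "a \<in> annulus \<rho>"
  then have "\<exists>k::int. t = \<rho> powi (2 * k - 1)"
    by (intro odd_int_cases[THEN iffD2] exI[of _ m])
  then obtain k :: int where "t = \<rho> powi (2 * k - 1)" ..
  then show "{z \<in> annulus \<rho>. szego \<rho> t z a = 0} = {- of_real \<rho> / cnj a}"
    using szego_zeros_odd_power[OF assms(1,2) _ a] by simp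
qed

end
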